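(* Let $q$ be a prime power with $q\equiv 3 \pmod 4$. Then there exists a $q$-dimensional difference set with parameters $(q,(q-1)/2,(q-3)/4)$ in the additive group of the finite field $\mathbb{F}_q$ of order $q$.
   Context: Let $G$ be an additively written (not necessarily abelian) group of order $v$. A $(v,k,\lambda)$ difference set in $G$ is a subset $D\subseteq G$ of size $k$ such that every $g\in G\setminus\{0\}$ can be written as $g=d_1-d_2$ for exactly $\lambda$ choices of $(d_1,d_2)\in D\times D$. An $n$-dimensional $(v,k,\lambda)$ difference set in $G$ is a set of $n$-tuples $D\subseteq G^n$ of size $k$ such that for all $1\le x<y\le n$ the set $\{d_x-d_y\mid d\in D\}\subseteq G$ is a $(v,k,\lambda)$ difference set in $G$, where $d=(d_1,\ldots,d_n)$. *)

theory Defs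
  imports "HOL-Algebra.Ring" "HOL-Number_Theory.Prime_Powers" "HOL-Number_Theory.Cong"
begin

text \<open>
  Groups are the multiplicatively written groups of HOL-Algebra, so the difference
  \<open>a - b\<close> of an additively written group appears as \<open>a \<otimes> inv b\<close> and
  \<open>0\<close> as \<open>\<one>\<close>.
\<close>

definition difference_set :: "('a, 'b) monoid_scheme \<Rightarrow> nat \<Rightarrow> nat \<Rightarrow> nat \<Rightarrow> 'a set \<Rightarrow> bool"
  where "difference_set G v k l D \<longleftrightarrow>
    group G \<and> finite (carrier G) \<and> card (carrier G) = v \<and>
    D \<subseteq> carrier G \<and> card D = k \<and>
    (\<forall>g \<in> carrier G - {\<one>\<^bsub>G\<^esub>}.
      card {(d1, d2) \<in> D \<times> D. g = d1 \<otimes>\<^bsub>G\<^esub> inv\<^bsub>G\<^esub> d2} = l)"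

text \<open>An \<open>n\<close>-tuple over \<open>G\<close> is an extensional function on \<open>{1..n}\<close>.\<close>

definition multidim_difference_set ::
    "nat \<Rightarrow> ('a, 'b) monoid_scheme \<Rightarrow> nat \<Rightarrow> nat \<Rightarrow> nat \<Rightarrow> (nat \<Rightarrow> 'a) set \<Rightarrow> bool"
  where "multidim_difference_set n G v k l D \<longleftrightarrow>
    group G \<and> finite (carrier G) \<and> card (carrier G) = v \<and>
    D \<subseteq> ({1..n} \<rightarrow>\<^sub>E carrier G) \<and> card D = k \<and>
    (\<forall>x y. 1 \<le> x \<and> x < y \<and> y \<le> n \<longrightarrow>
      difference_set G v k l {d x \<otimes>\<^bsub>G\<^esub> inv\<^bsub>G\<^esub> (d y) | d. d \<in> D})"

end

theory Submission
  imports Defs "HOL-Algebra.Multiplicative_Group"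
begin

text \<open>
  Let \<open>S\<close> be the set of nonzero squares of a field \<open>F\<close> of order \<open>q = 4 m + 3\<close>. Squaring is
  two-to-one on the nonzero elements, so \<open>S\<close> has \<open>(q - 1) / 2 = 2 m + 1\<close> elements, and \<open>-1\<close> is
  not a square, so every nonzero element is \<open>s\<close> or \<open>-s\<close> for some \<open>s\<close> in \<open>S\<close>
  (\<open>nonzero_square_or_uminus\<close>).

  Let \<open>T\<close> be a set of size \<open>k = (q - 1) / 2\<close> that is closed under multiplication by \<open>S\<close>. The number
  of representations \<open>g = a - b\<close> with \<open>a\<close> and \<open>b\<close> in \<open>T\<close> does not change when \<open>g\<close> is multiplied
  by an element of \<open>S\<close>, nor when \<open>g\<close> is replaced by \<open>-g\<close> (swap \<open>a\<close> and \<open>b\<close>). Hence it has the same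
  value \<open>l\<close> for all nonzero \<open>g\<close>, and counting all pairs gives \<open>k * k = k + (q - 1) * l\<close>, that is
  \<open>l = (k - 1) / 2 = m\<close>. So every multiple \<open>c S\<close> with \<open>c \<noteq> 0\<close> is a Paley difference set.

  Now enumerate the field as \<open>e 1, \<dots>, e q\<close> and take the tuples \<open>(s e 1, \<dots>, s e q)\<close> for \<open>s\<close> in \<open>S\<close>.
  The differences of coordinates \<open>x\<close> and \<open>y\<close> form the set \<open>(e x - e y) S\<close>, and
  \<open>e x - e y \<noteq> 0\<close> for \<open>x \<noteq> y\<close>.
\<close>

section \<open>Squares in a field of order congruent to 3 modulo 4\<close>

locale field_order_3_mod_4 = field +
  fixes m :: nat
  assumes finite_carrier [simp, intro]: "finite (carrier R)"
    and card_carrier: "card (carrier R) = 4 * m + 3"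
begin

definition nonzero_squares :: "'a set" where
  "nonzero_squares = (\<lambda>x. x \<otimes> x) ` (carrier R - {\<zero>})"

lemma nonzero_squares_subset: "nonzero_squares \<subseteq> carrier R - {\<zero>}"
  by (auto simp: nonzero_squares_def integral_iff)

lemma finite_nonzero_squares: "finite nonzero_squares"
  by (simp add: nonzero_squares_def)

lemma nonzero_squares_mult_closed:
  assumes "s \<in> nonzero_squares" "t \<in> nonzero_squares"
  shows "s \<otimes> t \<in> nonzero_squares"
proof -
  obtain x y where xy: "x \<in> carrier R - {\<zero>}" "y \<in> carrier R - {\<zero>}"
    and eq: "s = x \<otimes> x" "t = y \<otimes> y"
    using assms by (auto simp: nonzero_squares_def)
  have "s \<otimes> t = (x \<otimes> y) \<otimes> (x \<otimes> y)"
    using xy by (simp add: eq m_ac)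
  moreover have "x \<otimes> y \<in> carrier R - {\<zero>}"
    using xy by (simp add: integral_iff)
  ultimately show ?thesis
    by (auto simp: nonzero_squares_def)
qed

lemma nonzero_squares_inv_closed:
  assumes "s \<in> nonzero_squares"
  shows "inv s \<in> nonzero_squares"
proof -
  obtain x where x: "x \<in> carrier R" "x \<noteq> \<zero>" and s: "s = x \<otimes> x"
    using assms by (auto simp: nonzero_squares_def)
  have inv: "inv x \<in> carrier R" "x \<otimes> inv x = \<one>" "inv x \<otimes> x = \<one>"
    using x by (auto simp: field_Units)
  have "(x \<otimes> x) \<otimes> (inv x \<otimes> inv x) = (x \<otimes> inv x) \<otimes> (x \<otimes> inv x)"
    using x(1) inv(1) by (simp add: m_ac)
  then have "inv s = inv x \<otimes> inv x"
    using x(1) inv by (intro comm_inv_char) (auto simp: s)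
  moreover have "inv x \<noteq> \<zero>"
    using inv x(1) by auto
  ultimately show ?thesis
    using inv(1) by (auto simp: nonzero_squares_def)
qed

text \<open>
  The additive group has odd order, so it has no element of order two.
\<close>

lemma one_neq_uminus_one: "\<one> \<noteq> \<ominus> \<one>"
proof
  assume "\<one> = \<ominus> \<one>"
  then have two: "\<one> \<oplus> \<one> = \<zero>"
    using r_neg[of \<one>] by simp
  have "[(2 :: nat)] \<cdot> \<one> = \<one> \<oplus> \<one>"
    by (simp add: numeral_2_eq_2)
  then have even: "[(2 * j :: nat)] \<cdot> \<one> = \<zero>" for j
    using two add.nat_pow_pow[of \<one> j 2] by simp
  have "\<zero> = [(4 * m + 3 :: nat)] \<cdot> \<one>"
    using add.pow_order_eq_1[of \<one>] card_carrier by (simp add: order_def)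
  also have "4 * m + 3 = Suc (2 * (2 * m + 1))" by simp
  also have "[(Suc (2 * (2 * m + 1)))] \<cdot> \<one> = \<one>"
    by (simp only: add.nat_pow_Suc even) simp
  finally show False by simp
qed

text \<open>
  An \<open>x\<close> with \<open>x\<^sup>2 = -1\<close> has \<open>x\<^sup>4 = 1\<close>. Since \<open>q - 1 = 4 m + 2\<close>, the \<open>(q - 1)\<close>-st power of \<open>x\<close>
  is then \<open>x\<^sup>2 = -1\<close>, whereas it is \<open>1\<close> for every nonzero element of the field.
\<close>

lemma uminus_one_not_square:
  assumes x: "x \<in> carrier R"
  shows "x \<otimes> x \<noteq> \<ominus> \<one>"
proof
  assume eq: "x \<otimes> x = \<ominus> \<one>"
  have nz: "x \<noteq> \<zero>"
    using eq by (metis minus_minus minus_zero one_closed r_null x zero_not_one)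
  have four: "x [^] (4 :: nat) = \<one>"
  proof -
    have "x [^] (4 :: nat) = (x \<otimes> x) \<otimes> (x \<otimes> x)"
      using x by (simp add: eval_nat_numeral m_assoc)
    then show ?thesis by (simp add: eq l_minus r_minus)
  qed
  interpret U: group "mult_of R"
    by (rule field_mult_group)
  have "x [^]\<^bsub>mult_of R\<^esub> order (mult_of R) = \<one>\<^bsub>mult_of R\<^esub>"
    by (rule U.pow_order_eq_1) (use x nz in auto)
  moreover have "order (mult_of R) = 4 * m + 2"
    by (simp add: order_def card_carrier)
  ultimately have "\<one> = x [^] (4 * m + 2 :: nat)"
    by (simp add: nat_pow_mult_of)
  also have "\<dots> = (x [^] (4 :: nat)) [^] m \<otimes> (x \<otimes> x)"
    using x by (simp add: nat_pow_pow nat_pow_mult [symmetric] numeral_2_eq_2 m_assoc)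
  also have "\<dots> = \<ominus> \<one>"
    by (simp add: four eq)
  finally show False
    using one_neq_uminus_one by simp
qed

lemma square_eq_iff:
  assumes x: "x \<in> carrier R" and y: "y \<in> carrier R"
  shows "x \<otimes> x = y \<otimes> y \<longleftrightarrow> x = y \<or> x = \<ominus> y"
proof
  assume eq: "x \<otimes> x = y \<otimes> y"
  have "(x \<oplus> \<ominus> y) \<otimes> (x \<oplus> y) = \<zero>"
    using x y eq by algebra
  then have "x \<oplus> \<ominus> y = \<zero> \<or> x \<oplus> y = \<zero>"
    using x y by (simp add: integral_iff)
  then show "x = y \<or> x = \<ominus> y"
    using x y by (metis a_inv_closed minus_equality minus_minus)
next
  assume "x = y \<or> x = \<ominus> y"
  then show "x \<otimes> x = y \<otimes> y"
    using y by (auto simp: l_minus r_minus)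
qed

lemma uminus_neq_self:
  assumes x: "x \<in> carrier R" "x \<noteq> \<zero>"
  shows "\<ominus> x \<noteq> x"
proof
  assume "\<ominus> x = x"
  then have "x \<otimes> \<ominus> \<one> = x \<otimes> \<one>"
    using x by (simp add: r_minus)
  then show False
    using x one_neq_uminus_one by (subst (asm) m_lcancel) auto
qed

text \<open>Each fibre of the squaring map on the nonzero elements is a pair \<open>{x, -x}\<close>.\<close>

lemma card_nonzero_squares: "card nonzero_squares = 2 * m + 1"
proof -
  let ?N = "carrier R - {\<zero>}"
  have fibre: "card {x \<in> ?N. x \<otimes> x = s} = 2" if sq: "s \<in> nonzero_squares" for s
  proof -
    obtain y where y: "y \<in> ?N" and s: "s = y \<otimes> y"
      using sq by (auto simp: nonzero_squares_def)
    have "\<ominus> y \<noteq> \<zero>"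
      using y minus_minus[of y] by auto
    then have "{x \<in> ?N. x \<otimes> x = s} = {y, \<ominus> y}"
      using y by (auto simp: s square_eq_iff)
    then show ?thesis
      using y uminus_neq_self[of y] by simp
  qed
  have "card ?N = (\<Sum>s\<in>nonzero_squares. card {x \<in> ?N. x \<otimes> x = s})"
    using sum.image_gen[of ?N "\<lambda>_. 1 :: nat" "\<lambda>x. x \<otimes> x"]
    by (simp add: nonzero_squares_def)
  also have "\<dots> = card nonzero_squares * 2"
    using fibre by (simp del: Diff_iff)
  finally show ?thesis
    by (simp add: card_carrier)
qed

text \<open>
  The sets \<open>S\<close> and \<open>-S\<close> are disjoint since \<open>-1\<close> is not a square, and each contains half of the
  nonzero elements.
\<close>

lemma nonzero_square_or_uminus:
  assumes g: "g \<in> carrier R" "g \<noteq> \<zero>"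
  shows "g \<in> nonzero_squares \<or> \<ominus> g \<in> nonzero_squares"
proof -
  let ?N = "carrier R - {\<zero>}" and ?M = "(\<lambda>s. \<ominus> s) ` nonzero_squares"
  have disj: "nonzero_squares \<inter> ?M = {}"
  proof (rule ccontr)
    assume "nonzero_squares \<inter> ?M \<noteq> {}"
    then obtain x y where xy: "x \<in> ?N" "y \<in> ?N" and eq: "x \<otimes> x = \<ominus> (y \<otimes> y)"
      by (auto simp: nonzero_squares_def)
    have inv: "inv y \<in> carrier R" "y \<otimes> inv y = \<one>"
      using xy by (auto simp: field_Units)
    have "(x \<otimes> inv y) \<otimes> (x \<otimes> inv y) = (x \<otimes> x) \<otimes> (inv y \<otimes> inv y)"
      using xy inv by (simp add: m_ac)
    also have "\<dots> = \<ominus> ((y \<otimes> inv y) \<otimes> (y \<otimes> inv y))"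
      using xy inv(1) by (simp add: eq l_minus r_minus m_ac)
    also have "\<dots> = \<ominus> \<one>"
      by (simp add: inv)
    finally show False
      using uminus_one_not_square[of "x \<otimes> inv y"] xy inv by simp
  qed
  have "inj_on (\<lambda>s. \<ominus> s) nonzero_squares"
    using nonzero_squares_subset by (intro inj_onI) (metis Diff_iff minus_minus subsetD)
  then have "card (nonzero_squares \<union> ?M) = card ?N"
    using disj by (simp add: card_Un_disjoint finite_nonzero_squares card_image
        card_nonzero_squares card_carrier)
  moreover have "nonzero_squares \<union> ?M \<subseteq> ?N"
    using nonzero_squares_subset minus_minus by force
  ultimately have "nonzero_squares \<union> ?M = ?N"
    by (intro card_subset_eq) auto
  then have "g \<in> nonzero_squares \<union> ?M"
    using g by simp
  then show ?thesis
    using nonzero_squares_subset by auto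
qed

section \<open>Numbers of representations as a difference\<close>

definition difference_pairs :: "'a set \<Rightarrow> 'a \<Rightarrow> ('a \<times> 'a) set" where
  "difference_pairs T g = {(a, b) \<in> T \<times> T. g = a \<ominus> b}"

lemma finite_difference_pairs: "finite T \<Longrightarrow> finite (difference_pairs T g)"
  by (rule finite_subset[of _ "T \<times> T"]) (auto simp: difference_pairs_def)

lemma card_difference_pairs_le_mult:
  assumes T: "T \<subseteq> carrier R" and inv: "\<And>s t. s \<in> nonzero_squares \<Longrightarrow> t \<in> T \<Longrightarrow> s \<otimes> t \<in> T"
    and s: "s \<in> nonzero_squares"
  shows "card (difference_pairs T g) \<le> card (difference_pairs T (s \<otimes> g))"
proof (rule card_inj_on_le)
  have s': "s \<in> carrier R" "s \<noteq> \<zero>"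
    using s nonzero_squares_subset by auto
  show "inj_on (map_prod ((\<otimes>) s) ((\<otimes>) s)) (difference_pairs T g)"
    using T s' by (auto simp: inj_on_def difference_pairs_def m_lcancel subset_iff)
  show "map_prod ((\<otimes>) s) ((\<otimes>) s) ` difference_pairs T g \<subseteq> difference_pairs T (s \<otimes> g)"
    using T s s' by (auto simp: difference_pairs_def inv a_minus_def r_distr r_minus subset_iff)
  show "finite (difference_pairs T (s \<otimes> g))"
    using T finite_subset[OF T] by (simp add: finite_difference_pairs)
qed

lemma card_difference_pairs_uminus:
  assumes T: "T \<subseteq> carrier R" and g: "g \<in> carrier R"
  shows "card (difference_pairs T (\<ominus> g)) = card (difference_pairs T g)"
proof (rule bij_betw_same_card)
  have neg: "\<ominus> (a \<ominus> b) = b \<ominus> a" if "a \<in> carrier R" "b \<in> carrier R" for a b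
    using that by algebra
  show "bij_betw prod.swap (difference_pairs T (\<ominus> g)) (difference_pairs T g)"
    by (rule bij_betwI[of _ _ _ prod.swap])
      (use T g neg in \<open>auto simp: difference_pairs_def subset_iff, (metis minus_minus)\<close>)
qed

text \<open>
  Multiplication by \<open>s\<close> gives one inequality between the numbers of representations of \<open>1\<close>
  and of \<open>s\<close>; multiplication by \<open>s\<^sup>-\<^sup>1\<close>, again a square, gives the other.
\<close>

lemma card_difference_pairs_nonzero:
  assumes T: "T \<subseteq> carrier R" and inv: "\<And>s t. s \<in> nonzero_squares \<Longrightarrow> t \<in> T \<Longrightarrow> s \<otimes> t \<in> T"
    and g: "g \<in> carrier R" "g \<noteq> \<zero>"
  shows "card (difference_pairs T g) = card (difference_pairs T \<one>)"
proof -
  have square: "card (difference_pairs T s) = card (difference_pairs T \<one>)"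
    if s: "s \<in> nonzero_squares" for s
  proof (rule antisym)
    have s': "s \<in> carrier R" "s \<noteq> \<zero>"
      using s nonzero_squares_subset by auto
    show "card (difference_pairs T \<one>) \<le> card (difference_pairs T s)"
      using card_difference_pairs_le_mult[OF T inv s, of \<one>] s' by simp
    have "inv s \<otimes> s = \<one>"
      using s' by (simp add: field_Units)
    with card_difference_pairs_le_mult[OF T inv nonzero_squares_inv_closed[OF s], of s]
    show "card (difference_pairs T s) \<le> card (difference_pairs T \<one>)"
      by simp
  qed
  from nonzero_square_or_uminus[OF g] show ?thesis
  proof
    assume "\<ominus> g \<in> nonzero_squares"
    then show ?thesis
      using square card_difference_pairs_uminus[OF T g(1)] by simp
  qed (rule square)
qed

text \<open>
  Every pair of elements of \<open>T\<close> represents exactly one element; the \<open>|T|\<close> pairs on the diagonal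
  represent \<open>0\<close>, and the other pairs are spread evenly over the \<open>4 m + 2 = 2 |T|\<close> nonzero
  elements.
\<close>

lemma card_difference_pairs:
  assumes T: "T \<subseteq> carrier R" and inv: "\<And>s t. s \<in> nonzero_squares \<Longrightarrow> t \<in> T \<Longrightarrow> s \<otimes> t \<in> T"
    and card_T: "card T = 2 * m + 1" and g: "g \<in> carrier R" "g \<noteq> \<zero>"
  shows "card (difference_pairs T g) = m"
proof -
  let ?N = "carrier R - {\<zero>}" and ?l = "card (difference_pairs T \<one>)"
  have fin: "finite T"
    using T by (rule finite_subset) simp
  have "\<zero> = a \<ominus> b \<longleftrightarrow> a = b" if "a \<in> T" "b \<in> T" for a b
    using T that r_right_minus_eq[of a b] by (metis subsetD)
  then have zero: "difference_pairs T \<zero> = (\<lambda>a. (a, a)) ` T"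
    by (auto simp: difference_pairs_def)
  have card_zero: "card (difference_pairs T \<zero>) = 2 * m + 1"
    unfolding zero by (subst card_image) (auto simp: inj_on_def card_T)
  have "T \<times> T = (\<Union>h\<in>carrier R. difference_pairs T h)"
    using T minus_closed by (auto simp: difference_pairs_def subset_iff)
  then have "(2 * m + 1) * (2 * m + 1) = card (\<Union>h\<in>carrier R. difference_pairs T h)"
    using card_cartesian_product[of T T] card_T by simp
  also have "\<dots> = (\<Sum>h\<in>carrier R. card (difference_pairs T h))"
  proof (rule card_UN_disjoint)
    show "\<forall>h\<in>carrier R. finite (difference_pairs T h)"
      by (simp add: fin finite_difference_pairs)
    show "\<forall>g\<in>carrier R. \<forall>h\<in>carrier R. g \<noteq> h \<longrightarrow> difference_pairs T g \<inter> difference_pairs T h = {}"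
      by (auto simp: difference_pairs_def)
  qed simp
  also have "\<dots> = (2 * m + 1) + (\<Sum>h\<in>?N. card (difference_pairs T h))"
    by (simp add: sum.remove[of _ \<zero>] card_zero)
  also have "(\<Sum>h\<in>?N. card (difference_pairs T h)) = (\<Sum>h\<in>?N. ?l)"
    by (intro sum.cong refl card_difference_pairs_nonzero[OF T inv]) auto
  also have "\<dots> = (2 * m + 1) * (2 * ?l)"
    by (simp add: card_carrier)
  finally have "(2 * m + 1) * (2 * m + 1) = (2 * m + 1) * (1 + 2 * ?l)"
    by (simp add: algebra_simps)
  then have "2 * m + 1 = 1 + 2 * ?l"
    by (simp only: mult_cancel1) simp
  then show ?thesis
    using card_difference_pairs_nonzero[OF T inv g] by simp
qed

section \<open>Paley difference sets in one and several dimensions\<close>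

lemma difference_set_if_nonzero_squares_invariant:
  assumes T: "T \<subseteq> carrier R" and inv: "\<And>s t. s \<in> nonzero_squares \<Longrightarrow> t \<in> T \<Longrightarrow> s \<otimes> t \<in> T"
    and card_T: "card T = 2 * m + 1"
  shows "difference_set (add_monoid R) (4 * m + 3) (2 * m + 1) m T"
proof -
  have "{(a, b) \<in> T \<times> T. g = a \<otimes>\<^bsub>add_monoid R\<^esub> inv\<^bsub>add_monoid R\<^esub> b} = difference_pairs T g" for g
    by (simp add: difference_pairs_def a_minus_def a_inv_def)
  then show ?thesis
    using T card_T card_difference_pairs[OF T inv card_T]
    by (simp add: difference_set_def add.is_group card_carrier)
qed

lemma difference_set_multiple_nonzero_squares:
  assumes c: "c \<in> carrier R" "c \<noteq> \<zero>"
  shows "difference_set (add_monoid R) (4 * m + 3) (2 * m + 1) m ((\<lambda>s. s \<otimes> c) ` nonzero_squares)"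
proof (rule difference_set_if_nonzero_squares_invariant)
  have sub: "s \<in> carrier R" if "s \<in> nonzero_squares" for s
    using that nonzero_squares_subset by auto
  show "(\<lambda>s. s \<otimes> c) ` nonzero_squares \<subseteq> carrier R"
    using c sub by auto
  show "s \<otimes> t \<in> (\<lambda>s. s \<otimes> c) ` nonzero_squares"
    if "s \<in> nonzero_squares" "t \<in> (\<lambda>s. s \<otimes> c) ` nonzero_squares" for s t
    using that c sub nonzero_squares_mult_closed by (auto simp: m_assoc [symmetric])
  have "inj_on (\<lambda>s. s \<otimes> c) nonzero_squares"
    using c sub by (auto simp: inj_on_def m_rcancel)
  then show "card ((\<lambda>s. s \<otimes> c) ` nonzero_squares) = 2 * m + 1"
    by (simp add: card_image card_nonzero_squares)
qed

lemma multidim_difference_set_exists: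
  "\<exists>D. multidim_difference_set (4 * m + 3) (add_monoid R) (4 * m + 3) (2 * m + 1) m D"
proof -
  define n where "n = 4 * m + 3"
  have "card {1..n} = card (carrier R)"
    by (simp add: card_carrier n_def)
  then obtain e where e: "bij_betw e {1..n} (carrier R)"
    using finite_same_card_bij[of "{1..n}" "carrier R"] by auto
  define tuple where "tuple s = (\<lambda>x\<in>{1..n}. s \<otimes> e x)" for s
  have e_closed: "e x \<in> carrier R" if "x \<in> {1..n}" for x
    using that e by (auto simp: bij_betw_def)
  have sub: "s \<in> carrier R" if "s \<in> nonzero_squares" for s
    using that nonzero_squares_subset by auto
  have "inj_on tuple nonzero_squares"
  proof (rule inj_onI)
    fix s t assume st: "s \<in> nonzero_squares" "t \<in> nonzero_squares" and eq: "tuple s = tuple t"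
    obtain x where x: "x \<in> {1..n}" "e x = \<one>"
      using e one_closed by (metis bij_betw_def imageE)
    \<comment> \<open>A multiplier can be read off at the coordinate where the enumeration takes the value \<open>1\<close>.\<close>
    have "s \<otimes> \<one> = t \<otimes> \<one>"
      using fun_cong[OF eq, of x] x by (simp add: tuple_def)
    then show "s = t"
      using st sub by simp
  qed
  then have card: "card (tuple ` nonzero_squares) = 2 * m + 1"
    by (simp add: card_image card_nonzero_squares)
  have diff: "difference_set (add_monoid R) n (2 * m + 1) m
      {d x \<otimes>\<^bsub>add_monoid R\<^esub> inv\<^bsub>add_monoid R\<^esub> (d y) | d. d \<in> tuple ` nonzero_squares}"
    if xy: "1 \<le> x" "x < y" "y \<le> n" for x y
  proof -
    have x: "x \<in> {1..n}" and y: "y \<in> {1..n}"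
      using xy by auto
    have "e x \<noteq> e y"
      using inj_onD[OF bij_betw_imp_inj_on[OF e] _ x y] xy by auto
    then have c: "e x \<ominus> e y \<noteq> \<zero>"
      using e_closed x y by (simp add: r_right_minus_eq)
    have "tuple s x \<otimes>\<^bsub>add_monoid R\<^esub> inv\<^bsub>add_monoid R\<^esub> (tuple s y) = s \<otimes> (e x \<ominus> e y)"
      if "s \<in> nonzero_squares" for s
    proof -
      have "tuple s x \<otimes>\<^bsub>add_monoid R\<^esub> inv\<^bsub>add_monoid R\<^esub> (tuple s y) = s \<otimes> e x \<oplus> \<ominus> (s \<otimes> e y)"
        using x y by (simp add: tuple_def a_inv_def)
      also have "\<dots> = s \<otimes> (e x \<ominus> e y)"
        using that sub e_closed x y by (simp add: a_minus_def r_distr r_minus)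
      finally show ?thesis .
    qed
    then have "{d x \<otimes>\<^bsub>add_monoid R\<^esub> inv\<^bsub>add_monoid R\<^esub> (d y) | d. d \<in> tuple ` nonzero_squares}
        = (\<lambda>s. s \<otimes> (e x \<ominus> e y)) ` nonzero_squares"
      by (force simp: image_def)
    then show ?thesis
      using difference_set_multiple_nonzero_squares[OF _ c] e_closed x y by (simp add: n_def)
  qed
  have "tuple ` nonzero_squares \<subseteq> {1..n} \<rightarrow>\<^sub>E carrier R"
    using sub e_closed by (auto simp: tuple_def)
  then have "multidim_difference_set n (add_monoid R) n (2 * m + 1) m (tuple ` nonzero_squares)"
    using card diff by (simp add: multidim_difference_set_def add.is_group card_carrier n_def)
  then show ?thesis
    unfolding n_def by blast
qed

end

theorem theorem4p1:
  fixes q :: nat and F :: "('a, 'b) ring_scheme"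
  assumes "primepow q" and "[q = 3] (mod 4)"
    and "field F" and "finite (carrier F)" and "card (carrier F) = q"
  shows "\<exists>D. multidim_difference_set q (add_monoid F) q ((q - 1) div 2) ((q - 3) div 4) D"
proof -
  define m where "m = q div 4"
  have q: "q = 4 * m + 3"
    using assms(2) div_mult_mod_eq[of q 4] by (simp add: cong_def m_def)
  have "field_order_3_mod_4 F m"
    using assms q by (simp add: field_order_3_mod_4_def field_order_3_mod_4_axioms_def)
  moreover have "(q - 1) div 2 = 2 * m + 1" "(q - 3) div 4 = m"
    by (simp_all add: q)
  ultimately show ?thesis
    using field_order_3_mod_4.multidim_difference_set_exists[of F m] by (simp add: q)
qed

end
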